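(* Let $(X,d)$ be a compact metric space, let $\mathbb{I}=\{S_i\}_{i=1}^N$ be an iterated function system on $X$ satisfying bounded distortion, and let $C\subseteq X$ be a non-empty compact set. Let $F_\emptyset$ be the homogeneous attractor of $\mathbb{I}$ and $F_C$ the inhomogeneous attractor of $\mathbb{I}$ with condensation set $C$. If $\mathbb{I}$ satisfies the strong open set condition, then $$\overline{\dim}_B F_C=\max\{\overline{\dim}_B F_\emptyset,\ \overline{\dim}_B C\}.$$
   Context: An iterated function system (IFS) on $X$ is a finite collection $\mathbb{I}=\{S_i\}_{i=1}^N$ of contractions $S_i:X\to X$. Its homogeneous attractor $F_\emptyset$ is the unique non-empty compact set with $F_\emptyset=\bigcup_{i=1}^N S_i(F_\emptyset)$. For compact $C\subseteq X$, the inhomogeneous attractor $F_C$ with condensation set $C$ is the unique non-empty compact set with $F_C=\bigcup_{i=1}^N S_i(F_C)\cup C$. For $S:X\to X$ let $\mathrm{Lip}^+(S)=\sup_{x\ne y} d(S(x),S(y))/d(x,y)$ and $\mathrm{Lip}^-(S)=\inf_{x\neq y} d(S(x),S(y))/d(x,y)$. Let $\mathcal{I}=\{1,\dots,N\}$, $\mathcal{I}^*=\bigcup_{k\ge1}\mathcal{I}^k$, and for $\mathbf{i}=(i_1,\dots,i_k)\in\mathcal{I}^k$ write $S_{\mathbf{i}}=S_{i_1}\circ\cdots\circ S_{i_k}$. Bounded distortion: there is a uniform constant $L>1$ such that $\mathrm{Lip}^+(S_{\mathbf{i}})/\mathrm{Lip}^-(S_{\mathbf{i}})<L$ for all $\mathbf{i}\in\mathcal{I}^*$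 (in particular $\mathrm{Lip}^-(S_{\mathbf{i}})>0$, so all the maps are bi-Lipschitz contractions). Strong open set condition (SOSC): there is a non-empty open set $U\subseteq X$ with $F_\emptyset\cap U\ne\emptyset$ and $\bigcup_{i=1}^N S_i(U)\subseteq U$ with the union disjoint. For a non-empty set $F\subseteq X$, $\overline{\dim}_B F=\limsup_{\delta\to0}\frac{\log N_\delta(F)}{-\log\delta}$, where $N_\delta(F)$ is the minimum number of balls of diameter $\delta$ required to cover $F$. *)

theory Defs
  imports "HOL-Analysis.Analysis"
begin

text \<open>The ambient space \<open>X\<close> is the carrier of a type of class \<^class>\<open>metric_space\<close>. An iterated function
  system \<open>{S\<^sub>1, \<dots>, S\<^sub>N}\<close> is given by an indexed family \<open>S\<close>, of which only the indices \<open>{1..N}\<close> are used.\<close>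

definition contraction :: "('a::metric_space \<Rightarrow> 'a) \<Rightarrow> bool" where
  "contraction f \<longleftrightarrow> (\<exists>c<1. c-lipschitz_on UNIV f)"

definition ifs :: "nat \<Rightarrow> (nat \<Rightarrow> 'a::metric_space \<Rightarrow> 'a) \<Rightarrow> bool" where
  "ifs N S \<longleftrightarrow> N \<ge> 1 \<and> (\<forall>i\<in>{1..N}. contraction (S i))"

definition inhomogeneous_attractor ::
    "nat \<Rightarrow> (nat \<Rightarrow> 'a::metric_space \<Rightarrow> 'a) \<Rightarrow> 'a set \<Rightarrow> 'a set \<Rightarrow> bool" where
  "inhomogeneous_attractor N S C F \<longleftrightarrow>
     F \<noteq> {} \<and> compact F \<and> F = (\<Union>i\<in>{1..N}. S i ` F) \<union> C"

definition homogeneous_attractor ::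
    "nat \<Rightarrow> (nat \<Rightarrow> 'a::metric_space \<Rightarrow> 'a) \<Rightarrow> 'a set \<Rightarrow> bool" where
  "homogeneous_attractor N S F \<longleftrightarrow>
     F \<noteq> {} \<and> compact F \<and> F = (\<Union>i\<in>{1..N}. S i ` F)"

text \<open>Both constants take values in \<^typ>\<open>ennreal\<close>, so that on a one-point space, where there are no pairs
  \<open>x \<noteq> y\<close>, they get the values \<open>0\<close> (supremum) and \<open>\<infinity>\<close> (infimum).\<close>

definition Lip_upper :: "('a::metric_space \<Rightarrow> 'a) \<Rightarrow> ennreal" where
  "Lip_upper f = (SUP (x, y)\<in>{(x, y). x \<noteq> y}. ennreal (dist (f x) (f y) / dist x y))"

definition Lip_lower :: "('a::metric_space \<Rightarrow> 'a) \<Rightarrow> ennreal" where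
  "Lip_lower f = (INF (x, y)\<in>{(x, y). x \<noteq> y}. ennreal (dist (f x) (f y) / dist x y))"

definition word_map :: "(nat \<Rightarrow> 'a \<Rightarrow> 'a) \<Rightarrow> nat list \<Rightarrow> 'a \<Rightarrow> 'a" where
  "word_map S w = foldr (\<lambda>i f. S i \<circ> f) w id"

text \<open>Positivity of the lower constant is stated explicitly because \<open>0 / 0 = 0\<close> in \<^typ>\<open>ennreal\<close>, so the
  inequality alone would admit constant maps.\<close>

definition bounded_distortion :: "nat \<Rightarrow> (nat \<Rightarrow> 'a::metric_space \<Rightarrow> 'a) \<Rightarrow> bool" where
  "bounded_distortion N S \<longleftrightarrow>
     (\<exists>L::real. L > 1 \<and>
        (\<forall>w\<in>lists {1..N}. w \<noteq> [] \<longrightarrow>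
           Lip_lower (word_map S w) > 0 \<and>
           Lip_upper (word_map S w) / Lip_lower (word_map S w) < ennreal L))"

text \<open>The last argument is the homogeneous attractor of the system.\<close>

definition strong_open_set_condition ::
    "nat \<Rightarrow> (nat \<Rightarrow> 'a::metric_space \<Rightarrow> 'a) \<Rightarrow> 'a set \<Rightarrow> bool" where
  "strong_open_set_condition N S F \<longleftrightarrow>
     (\<exists>U. open U \<and> U \<noteq> {} \<and> F \<inter> U \<noteq> {} \<and>
          (\<Union>i\<in>{1..N}. S i ` U) \<subseteq> U \<and> disjoint_family_on (\<lambda>i. S i ` U) {1..N})"

text \<open>A ball of diameter \<open>\<delta>\<close> is a closed ball of radius \<open>\<delta> / 2\<close>; in a general metric space its diameter
  as a set may be smaller. The least number exists whenever \<open>F\<close> is totally bounded, in particular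
  whenever the ambient space is compact.\<close>

definition covering_number :: "real \<Rightarrow> 'a::metric_space set \<Rightarrow> nat" where
  "covering_number \<delta> F =
     (LEAST n. \<exists>T. finite T \<and> card T = n \<and> F \<subseteq> (\<Union>x\<in>T. cball x (\<delta> / 2)))"

text \<open>The value may be \<open>\<infinity>\<close>, even on a compact space.\<close>

definition upper_box_dim :: "'a::metric_space set \<Rightarrow> ereal" where
  "upper_box_dim F =
     Limsup (at_right 0) (\<lambda>\<delta>::real. ereal (ln (real (covering_number \<delta> F)) / (- ln \<delta>)))"

end

theory Submission
  imports Defs
begin

text \<open>
  The lower bound is monotonicity, as \<open>F\<^sub>\<emptyset> \<subseteq> F\<^sub>C\<close>. For the upper bound write \<open>r(w)\<close> for the upper Lipschitz
  constant of \<open>S\<^sub>w\<close> and let \<open>s\<close> exceed both dimensions. Up to a factor, \<open>F\<^sub>C\<close> is covered at scale \<open>\<delta>\<close> by a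
  cover of \<open>F\<^sub>\<emptyset>\<close>, which takes care of all images \<open>S\<^sub>w(X)\<close> with \<open>r(w) < \<delta>\<close>, and by the images under \<open>S\<^sub>w\<close> of
  covers of \<open>C\<close> at scale \<open>\<delta>/r(w)\<close>, for the words with \<open>r(w) \<ge> \<delta>\<close>. This costs at most a constant times
  \<open>\<delta>\<^sup>-\<^sup>s\<close> times \<open>\<Sum>\<^sub>w r(w)\<^sup>s\<close>, so it remains to see that the sum is finite. Let \<open>Z\<^sub>k(s)\<close> be its part over words of
  length \<open>k\<close>. As \<open>Z\<close> is submultiplicative in \<open>k\<close>, it suffices that \<open>Z\<^sub>k(s) < 1\<close> for some \<open>k > 0\<close>. Otherwise
  \<open>Z\<^sub>k(t)\<close> is unbounded for every \<open>t < s\<close>. By the strong open set condition some piece \<open>S\<^sub>u(F\<^sub>\<emptyset>)\<close> lies in \<open>U\<close>;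
  then the compact sets \<open>S\<^sub>w(S\<^sub>u(F\<^sub>\<emptyset>))\<close> with \<open>w\<close> of length \<open>k\<close> are pairwise disjoint, hence separated, and
  bounded distortion together with \<open>Z\<^sub>k(t)\<close> being large gives \<open>dim F\<^sub>\<emptyset> \<ge> t\<close> for a \<open>t\<close> above that dimension
  (Schief's argument).
\<close>

section \<open>Covering numbers in a compact space\<close>

lemma covering_number_le:
  assumes "finite T" "F \<subseteq> (\<Union>x\<in>T. cball x (\<delta> / 2))"
  shows "covering_number \<delta> F \<le> card T"
  unfolding covering_number_def by (rule Least_le) (use assms in blast)

text \<open>Total boundedness of the compact space provides a finite cover, so the
  \<open>LEAST\<close> in the definition is taken over a nonempty set and its value is
  realised.\<close>

lemma covering_number_attained:
  fixes F :: "'a::metric_space set"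
  assumes "compact (UNIV :: 'a set)" "\<delta> > 0"
  obtains T where "finite T" "card T = covering_number \<delta> F" "F \<subseteq> (\<Union>x\<in>T. cball x (\<delta> / 2))"
proof -
  obtain T :: "'a set" where T: "finite T" "UNIV \<subseteq> (\<Union>x\<in>T. ball x (\<delta> / 2))"
    using assms unfolding compact_eq_totally_bounded by (metis half_gt_zero)
  then have "F \<subseteq> (\<Union>x\<in>T. cball x (\<delta> / 2))"
    by (meson ball_subset_cball UN_mono order_refl subset_trans subset_UNIV)
  then have "\<exists>T. finite T \<and> card T = card T \<and> F \<subseteq> (\<Union>x\<in>T. cball x (\<delta> / 2))"
    using T by blast
  then have "\<exists>n T. finite T \<and> card T = n \<and> F \<subseteq> (\<Union>x\<in>T. cball x (\<delta> / 2))"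
    by blast
  from LeastI_ex[OF this] show thesis
    using that unfolding covering_number_def by blast
qed

lemma covering_number_mono:
  fixes F :: "'a::metric_space set"
  assumes "compact (UNIV :: 'a set)" "0 < \<delta>" "\<delta> \<le> \<epsilon>" "F \<subseteq> G"
  shows "covering_number \<epsilon> F \<le> covering_number \<delta> G"
proof -
  obtain T where T: "finite T" "card T = covering_number \<delta> G" "G \<subseteq> (\<Union>x\<in>T. cball x (\<delta> / 2))"
    using covering_number_attained[OF assms(1,2)] .
  have "(\<Union>x\<in>T. cball x (\<delta> / 2)) \<subseteq> (\<Union>x\<in>T. cball x (\<epsilon> / 2))"
    using assms(3) by (intro UN_mono subset_cball) auto
  then show ?thesis
    using covering_number_le[OF T(1), of F \<epsilon>] T assms(4) by force
qed

lemma covering_number_pos: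
  fixes F :: "'a::metric_space set"
  assumes "compact (UNIV :: 'a set)" "0 < \<delta>" "F \<noteq> {}"
  shows "0 < covering_number \<delta> F"
proof -
  obtain T where T: "finite T" "card T = covering_number \<delta> F" "F \<subseteq> (\<Union>x\<in>T. cball x (\<delta> / 2))"
    using covering_number_attained[OF assms(1,2)] .
  with assms(3) have "T \<noteq> {}" by auto
  with T show ?thesis using card_gt_0_iff by metis
qed

text \<open>Two points in one ball of radius \<open>\<delta> / 2\<close> are at distance at most
  \<open>\<delta>\<close>, so each ball of an optimal cover holds at most one point of
  \<open>E\<close>. The balls are closed, hence the strict inequality in \<open>sep\<close>.\<close>

lemma card_separated_le_covering_number:
  fixes F :: "'a::metric_space set"
  assumes "compact (UNIV :: 'a set)" "0 < \<delta>" "E \<subseteq> F"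
    and sep: "\<And>x y. x \<in> E \<Longrightarrow> y \<in> E \<Longrightarrow> x \<noteq> y \<Longrightarrow> \<delta> < dist x y"
  shows "card E \<le> covering_number \<delta> F"
proof -
  obtain T where T: "finite T" "card T = covering_number \<delta> F" "F \<subseteq> (\<Union>x\<in>T. cball x (\<delta> / 2))"
    using covering_number_attained[OF assms(1,2)] .
  have "\<forall>x\<in>E. \<exists>t\<in>T. dist t x \<le> \<delta> / 2" using T(3) assms(3) by fastforce
  then obtain g where g: "\<And>x. x \<in> E \<Longrightarrow> g x \<in> T \<and> dist (g x) x \<le> \<delta> / 2" by metis
  have "inj_on g E"
  proof (rule inj_onI, rule ccontr)
    fix x y assume xy: "x \<in> E" "y \<in> E" "g x = g y" "x \<noteq> y"
    have "dist x y \<le> dist (g x) x + dist (g x) y"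
      by (metis dist_commute dist_triangle)
    with g[of x] g[of y] sep[of x y] xy show False by auto
  qed
  then show ?thesis using card_inj_on_le[of g E T] g T by auto
qed

section \<open>Upper box dimension and power bounds on covering numbers\<close>

lemma eventually_at_right_less_real: "(0::real) < a \<Longrightarrow> eventually (\<lambda>x. 0 < x \<and> x < a) (at_right 0)"
  using eventually_at_right_real[of 0 a] by (auto elim: eventually_mono)

lemma upper_box_dim_mono:
  fixes F :: "'a::metric_space set"
  assumes "compact (UNIV :: 'a set)" "F \<noteq> {}" "F \<subseteq> G"
  shows "upper_box_dim F \<le> upper_box_dim G"
  unfolding upper_box_dim_def
proof (rule Limsup_mono, rule eventually_mono[OF eventually_at_right_less_real[of 1]])
  fix \<delta> :: real assume d: "0 < \<delta> \<and> \<delta> < 1"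
  then have "0 < covering_number \<delta> F" "covering_number \<delta> F \<le> covering_number \<delta> G"
    using covering_number_pos covering_number_mono assms by blast+
  then show "ereal (ln (real (covering_number \<delta> F)) / - ln \<delta>)
      \<le> ereal (ln (real (covering_number \<delta> G)) / - ln \<delta>)"
    using d by (auto intro!: divide_right_mono simp del: divide_minus_right)
qed simp

lemma upper_box_dim_nonneg:
  fixes F :: "'a::metric_space set"
  assumes "compact (UNIV :: 'a set)" "F \<noteq> {}"
  shows "0 \<le> upper_box_dim F"
  unfolding upper_box_dim_def
proof (rule le_Limsup)
  show "\<forall>\<^sub>F \<delta> in at_right 0. 0 \<le> ereal (ln (real (covering_number \<delta> F)) / - ln \<delta>)"
  proof (rule eventually_mono[OF eventually_at_right_less_real[of 1]])
    fix \<delta> :: real assume d: "0 < \<delta> \<and> \<delta> < 1"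
    then have "0 < covering_number \<delta> F"
      using covering_number_pos assms by blast
    then show "0 \<le> ereal (ln (real (covering_number \<delta> F)) / - ln \<delta>)"
      using d by (auto intro!: divide_nonneg_nonneg simp del: divide_minus_right)
  qed simp
qed simp

text \<open>At small scales the limsup gives the bound with constant 1. On the remaining scales up
  to 1 the covering number is bounded by monotonicity, while \<open>\<delta> powr (- s)\<close> is
  at least 1.\<close>

lemma covering_number_bound_of_upper_box_dim_less:
  fixes F :: "'a::metric_space set"
  assumes X: "compact (UNIV :: 'a set)" and "F \<noteq> {}" and dim: "upper_box_dim F < ereal s"
  obtains K where "K > 0" "\<And>\<delta>. 0 < \<delta> \<Longrightarrow> \<delta> \<le> 1 \<Longrightarrow> real (covering_number \<delta> F) \<le> K * \<delta> powr (- s)"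
proof -
  have s: "0 < s"
    using upper_box_dim_nonneg[OF assms(1,2)] dim by (metis ereal_less(2) le_less_trans)
  have "eventually (\<lambda>\<delta>. ereal (ln (real (covering_number \<delta> F)) / (- ln \<delta>)) < ereal s) (at_right 0)"
    using dim unfolding upper_box_dim_def by (rule Limsup_lessD)
  then obtain a where a: "a > 0"
      "\<And>\<delta>. 0 < \<delta> \<Longrightarrow> \<delta> < a \<Longrightarrow> ln (real (covering_number \<delta> F)) / (- ln \<delta>) < s"
    unfolding eventually_at_right_field by auto
  \<comment> \<open>Scales below \<open>b\<close> satisfy the eventual bound and have
    \<open>- ln \<delta>\<close> positive; the covering number at \<open>b\<close> itself serves all
    other scales.\<close>
  define b where "b = min (a / 2) (1 / 2)"
  have b: "0 < b" "b < a" "b < 1" using a(1) unfolding b_def by auto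
  define K where "K = max 1 (real (covering_number b F))"
  show thesis
  proof (rule that[of K])
    show "K > 0" unfolding K_def by simp
    fix \<delta> :: real assume d: "0 < \<delta>" "\<delta> \<le> 1"
    show "real (covering_number \<delta> F) \<le> K * \<delta> powr (- s)"
    proof (cases "\<delta> < b")
      case True
      have pos: "0 < covering_number \<delta> F" using covering_number_pos[OF X d(1) assms(2)] .
      have "ln (real (covering_number \<delta> F)) \<le> s * (- ln \<delta>)"
        using a(2)[of \<delta>] d True b by (simp add: field_simps)
      then have "exp (ln (real (covering_number \<delta> F))) \<le> exp (s * (- ln \<delta>))"
        by (simp only: exp_le_cancel_iff)
      then have "real (covering_number \<delta> F) \<le> exp (s * (- ln \<delta>))"
        using pos by simp
      also have "\<dots> = \<delta> powr (- s)" using d by (simp add: powr_def)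
      also have "\<dots> \<le> K * \<delta> powr (- s)" unfolding K_def by (simp add: mult_le_cancel_right1)
      finally show ?thesis .
    next
      case False
      have "1 \<le> \<delta> powr (- s)"
        using d s powr_mono_both'[of "- s" 0 \<delta> 1] ge_one_powr_ge_zero[of "1 / \<delta>" s]
        by (simp add: powr_minus_divide powr_divide)
      moreover have "real (covering_number \<delta> F) \<le> K"
        using covering_number_mono[OF X b(1), of \<delta> F F] False unfolding K_def by simp
      moreover have "0 \<le> K" unfolding K_def by simp
      ultimately show ?thesis using mult_left_mono[of 1 "\<delta> powr (- s)" K] by linarith
    qed
  qed
qed

text \<open>As \<open>- ln \<delta>\<close> tends to infinity, the additive constant disappears:
  constant factors in a covering bound do not affect the dimension.\<close>

lemma tendsto_box_dim_exponent: "((\<lambda>\<delta>::real. ereal ((a + s * (- ln \<delta>)) / (- ln \<delta>))) \<longlongrightarrow> ereal s) (at_right 0)"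
proof -
  have "filterlim (\<lambda>\<delta>::real. - ln \<delta>) at_top (at_right 0)"
    unfolding filterlim_uminus_at_top by (simp add: ln_at_0)
  then have "((\<lambda>\<delta>::real. a / (- ln \<delta>) + s) \<longlongrightarrow> 0 + s) (at_right 0)"
    by (intro tendsto_add tendsto_const real_tendsto_divide_at_top[OF tendsto_const])
  moreover have "\<forall>\<^sub>F \<delta>::real in at_right 0. a / (- ln \<delta>) + s = (a + s * (- ln \<delta>)) / (- ln \<delta>)"
    by (rule eventually_mono[OF eventually_at_right_less_real[of 1]]) (auto simp: field_simps)
  ultimately show ?thesis
    by (intro tendsto_ereal) (simp add: tendsto_cong)
qed

text \<open>Replacing the scale by \<open>\<delta> / M\<close> changes the logarithm of the bound
  only by the constant \<open>s * ln M\<close>. The factor \<open>M\<close> leaves room for covers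
  whose balls are enlarged by a fixed factor.\<close>

lemma upper_box_dim_le:
  fixes F :: "'a::metric_space set"
  assumes X: "compact (UNIV :: 'a set)" and "F \<noteq> {}" "K > 0" "M > 0"
    and bound: "\<And>\<delta>. 0 < \<delta> \<Longrightarrow> \<delta> < 1 \<Longrightarrow> real (covering_number (M * \<delta>) F) \<le> K * \<delta> powr (- s)"
  shows "upper_box_dim F \<le> ereal s"
proof -
  have "upper_box_dim F \<le> Limsup (at_right 0) (\<lambda>\<delta>::real. ereal ((ln K + s * ln M + s * (- ln \<delta>)) / (- ln \<delta>)))"
    unfolding upper_box_dim_def
  proof (rule Limsup_mono, rule eventually_mono[OF eventually_at_right_less_real[of "min 1 M"]])
    fix \<delta> :: real assume d: "0 < \<delta> \<and> \<delta> < min 1 M"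
    then have "real (covering_number \<delta> F) \<le> K * (\<delta> / M) powr (- s)"
      using bound[of "\<delta> / M"] assms(4) by (simp add: field_simps)
    moreover have pos: "0 < covering_number \<delta> F"
      using covering_number_pos[OF X _ assms(2)] d by auto
    ultimately have "ln (real (covering_number \<delta> F)) \<le> ln (K * (\<delta> / M) powr (- s))"
      by (subst ln_le_cancel_iff) (auto intro: less_le_trans[rotated])
    also have "\<dots> = ln K + s * ln M + s * (- ln \<delta>)"
      using assms d by (simp add: ln_mult ln_div algebra_simps)
    finally show "ereal (ln (real (covering_number \<delta> F)) / - ln \<delta>)
       \<le> ereal ((ln K + s * ln M + s * (- ln \<delta>)) / (- ln \<delta>))"
      using d by (auto intro!: divide_right_mono simp del: divide_minus_right)
  qed (use assms in auto)
  also have "\<dots> = ereal s"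
    by (rule lim_imp_Limsup[OF _ tendsto_box_dim_exponent]) simp
  finally show ?thesis .
qed

lemma le_upper_box_dim:
  fixes F :: "'a::metric_space set"
  assumes "K > 0"
    and bound: "\<And>\<delta>. 0 < \<delta> \<Longrightarrow> \<delta> < 1 \<Longrightarrow> K * \<delta> powr (- s) \<le> real (covering_number \<delta> F)"
  shows "ereal s \<le> upper_box_dim F"
proof -
  have "ereal s = Limsup (at_right 0) (\<lambda>\<delta>::real. ereal ((ln K + s * (- ln \<delta>)) / (- ln \<delta>)))"
    by (rule lim_imp_Limsup[OF _ tendsto_box_dim_exponent, symmetric]) simp
  also have "\<dots> \<le> upper_box_dim F"
    unfolding upper_box_dim_def
  proof (rule Limsup_mono, rule eventually_mono[OF eventually_at_right_less_real[of 1]])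
    fix \<delta> :: real assume d: "0 < \<delta> \<and> \<delta> < 1"
    have pos: "0 < K * \<delta> powr (- s)" using d assms by simp
    have "ln K + s * (- ln \<delta>) = ln (K * \<delta> powr (- s))"
      using assms d by (simp add: ln_mult)
    also have "\<dots> \<le> ln (real (covering_number \<delta> F))"
      using bound[of \<delta>] d pos by (subst ln_le_cancel_iff) (auto intro: less_le_trans)
    finally show "ereal ((ln K + s * (- ln \<delta>)) / (- ln \<delta>)) \<le> ereal (ln (real (covering_number \<delta> F)) / - ln \<delta>)"
      using d by (auto intro!: divide_right_mono simp del: divide_minus_right)
  qed simp
  finally show ?thesis .
qed

section \<open>Packing lower bound for separated self-embeddings\<close>

text \<open>The packing is built recursively. For \<open>\<delta> < \<eta>\<close>, take a packing
  of \<open>F\<close> at scale \<open>\<delta> / p j\<close> for each \<open>j\<close> and map it by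
  \<open>f j\<close>: inside one piece the lower bound on \<open>f j\<close> restores the separation
  \<open>\<delta>\<close>, and different pieces are \<open>\<eta>\<close> apart. The cardinalities
  add up to the required one because the \<open>p j powr s\<close> sum to at least 1. The induction
  is on the number \<open>n\<close> of factors \<open>q\<close> needed to bring
  \<open>\<eta>\<close> down to \<open>\<delta>\<close>.\<close>

lemma separated_self_embeddings_packing:
  fixes F :: "'a::metric_space set" and f :: "'j \<Rightarrow> 'a \<Rightarrow> 'a"
  assumes J: "finite J" and F: "F \<noteq> {}" and q: "0 < q" "q < 1" and s: "0 \<le> s" and \<eta>: "0 < \<eta>"
    and into: "\<And>j x. j \<in> J \<Longrightarrow> x \<in> F \<Longrightarrow> f j x \<in> F"
    and p: "\<And>j. j \<in> J \<Longrightarrow> 0 < p j" "\<And>j. j \<in> J \<Longrightarrow> p j \<le> q"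
    and lower: "\<And>j x y. j \<in> J \<Longrightarrow> x \<in> F \<Longrightarrow> y \<in> F \<Longrightarrow> p j * dist x y \<le> dist (f j x) (f j y)"
    and sep: "\<And>i j x y. i \<in> J \<Longrightarrow> j \<in> J \<Longrightarrow> i \<noteq> j \<Longrightarrow> x \<in> F \<Longrightarrow> y \<in> F \<Longrightarrow> \<eta> \<le> dist (f i x) (f j y)"
    and sum: "1 \<le> (\<Sum>j\<in>J. p j powr s)"
    and \<delta>: "0 < \<delta>"
  obtains T where "finite T" "T \<subseteq> F" "(\<eta> / \<delta>) powr s \<le> real (card T)"
    "\<And>x y. x \<in> T \<Longrightarrow> y \<in> T \<Longrightarrow> x \<noteq> y \<Longrightarrow> \<delta> \<le> dist x y"
proof -
  have claim: "\<exists>T. finite T \<and> T \<subseteq> F \<and> (\<eta> / \<delta>) powr s \<le> real (card T) \<and>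
      (\<forall>x\<in>T. \<forall>y\<in>T. x \<noteq> y \<longrightarrow> \<delta> \<le> dist x y)"
    if "0 < \<delta>" "q ^ n * \<eta> \<le> \<delta>" for n \<delta>
    using that
  proof (induction n arbitrary: \<delta>)
    \<comment> \<open>Here \<open>\<eta> \<le> \<delta>\<close>, so the required cardinality is at
      most 1 and a single point suffices.\<close>
    case base: 0
    obtain x where x: "x \<in> F" using F by blast
    have "(\<eta> / \<delta>) powr s \<le> 1 powr s"
      using base \<eta> s by (intro powr_mono2) auto
    then show ?case using x by (intro exI[of _ "{x}"]) auto
  next
    case (Suc n)
    show ?case
    proof (cases "\<eta> \<le> \<delta>")
      case True
      obtain x where x: "x \<in> F" using F by blast
      have "(\<eta> / \<delta>) powr s \<le> 1 powr s"
        using True Suc \<eta> s by (intro powr_mono2) auto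
      then show ?thesis using x by (intro exI[of _ "{x}"]) auto
    next
      case False
      have "\<exists>T. finite T \<and> T \<subseteq> F \<and> (\<eta> / (\<delta> / p j)) powr s \<le> real (card T) \<and>
          (\<forall>x\<in>T. \<forall>y\<in>T. x \<noteq> y \<longrightarrow> \<delta> / p j \<le> dist x y)" if j: "j \<in> J" for j
      proof (rule Suc.IH)
        show "0 < \<delta> / p j" using Suc.prems p[OF j] by auto
        \<comment> \<open>As \<open>p j \<le> q\<close>, passing to the scale
          \<open>\<delta> / p j\<close> saves one factor \<open>q\<close>.\<close>
        have "p j * (q ^ n * \<eta>) \<le> q * (q ^ n * \<eta>)"
          using p[OF j] q \<eta> by (intro mult_right_mono) auto
        then show "q ^ n * \<eta> \<le> \<delta> / p j"
          using Suc.prems p[OF j] by (simp add: field_simps)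
      qed
      then obtain T where T: "\<And>j. j \<in> J \<Longrightarrow> finite (T j)" "\<And>j. j \<in> J \<Longrightarrow> T j \<subseteq> F"
        "\<And>j. j \<in> J \<Longrightarrow> (\<eta> / (\<delta> / p j)) powr s \<le> real (card (T j))"
        "\<And>j x y. j \<in> J \<Longrightarrow> x \<in> T j \<Longrightarrow> y \<in> T j \<Longrightarrow> x \<noteq> y \<Longrightarrow> \<delta> / p j \<le> dist x y"
        by metis
      define V where "V = (\<Union>j\<in>J. f j ` T j)"
      have inj: "inj_on (f j) (T j)" if j: "j \<in> J" for j
      proof (rule inj_onI, rule ccontr)
        fix x y assume "x \<in> T j" "y \<in> T j" "f j x = f j y" "x \<noteq> y"
        then show False using lower[OF j, of x y] p(1)[OF j] T(2)[OF j]
          by (auto simp: mult_le_0_iff)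
      qed
      have disj: "f i ` T i \<inter> f j ` T j = {}" if "i \<in> J" "j \<in> J" "i \<noteq> j" for i j
      proof (rule ccontr)
        assume "f i ` T i \<inter> f j ` T j \<noteq> {}"
        then obtain x y where "x \<in> T i" "y \<in> T j" "f i x = f j y" by auto
        then show False using sep[OF that, of x y] T(2) that \<eta> by auto
      qed
      have "card V = (\<Sum>j\<in>J. card (f j ` T j))"
        unfolding V_def using J T(1) disj by (intro card_UN_disjoint) auto
      also have "\<dots> = (\<Sum>j\<in>J. card (T j))"
        by (intro sum.cong refl card_image inj)
      finally have card: "real (card V) = (\<Sum>j\<in>J. real (card (T j)))" by simp
      have "(\<eta> / \<delta>) powr s \<le> (\<eta> / \<delta>) powr s * (\<Sum>j\<in>J. p j powr s)"
        using sum by (simp add: mult_le_cancel_left1)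
      also have "\<dots> = (\<Sum>j\<in>J. (\<eta> / (\<delta> / p j)) powr s)"
        unfolding sum_distrib_left
      proof (intro sum.cong refl)
        fix j assume "j \<in> J"
        then show "(\<eta> / \<delta>) powr s * p j powr s = (\<eta> / (\<delta> / p j)) powr s"
          using \<eta> Suc.prems p by (simp add: powr_mult[symmetric])
      qed
      also have "\<dots> \<le> real (card V)"
        unfolding card by (intro sum_mono T)
      finally have "(\<eta> / \<delta>) powr s \<le> real (card V)" .
      moreover have "finite V" "V \<subseteq> F"
        unfolding V_def using J T(1,2) into by (simp, blast)
      moreover have "\<delta> \<le> dist x y" if xy: "x \<in> V" "y \<in> V" "x \<noteq> y" for x y
      proof -
        obtain i j a b where ij: "i \<in> J" "j \<in> J" "a \<in> T i" "b \<in> T j" "x = f i a" "y = f j b"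
          using xy unfolding V_def by auto
        have ab: "a \<in> F" "b \<in> F" using ij T(2) by auto
        show ?thesis
        proof (cases "i = j")
          case True
          then have "\<delta> \<le> p i * dist a b"
            using T(4)[of i a b] ij xy p(1)[of i] by (auto simp: field_simps)
          then show ?thesis using lower[of i a b] ij ab True by auto
        next
          case False
          then show ?thesis using sep[of i j a b] ij ab \<open>\<not> \<eta> \<le> \<delta>\<close> by auto
        qed
      qed
      ultimately show ?thesis by blast
    qed
  qed
  obtain n where "q ^ n < \<delta> / \<eta>"
    using real_arch_pow_inv[of "\<delta> / \<eta>" q] \<delta> \<eta> q by auto
  then have "q ^ n * \<eta> \<le> \<delta>" using \<eta> by (simp add: field_simps)
  from claim[OF \<delta> this] obtain T where "finite T" "T \<subseteq> F" "(\<eta> / \<delta>) powr s \<le> real (card T)"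
    "\<forall>x\<in>T. \<forall>y\<in>T. x \<noteq> y \<longrightarrow> \<delta> \<le> dist x y"
    by blast
  then show thesis by (intro that[of T]) blast+
qed

lemma separated_self_embeddings_upper_box_dim:
  fixes F :: "'a::metric_space set" and f :: "'j \<Rightarrow> 'a \<Rightarrow> 'a"
  assumes X: "compact (UNIV :: 'a set)"
    and J: "finite J" and F: "F \<noteq> {}" and q: "0 < q" "q < 1" and s: "0 \<le> s" and \<eta>: "0 < \<eta>"
    and into: "\<And>j x. j \<in> J \<Longrightarrow> x \<in> F \<Longrightarrow> f j x \<in> F"
    and p: "\<And>j. j \<in> J \<Longrightarrow> 0 < p j" "\<And>j. j \<in> J \<Longrightarrow> p j \<le> q"
    and lower: "\<And>j x y. j \<in> J \<Longrightarrow> x \<in> F \<Longrightarrow> y \<in> F \<Longrightarrow> p j * dist x y \<le> dist (f j x) (f j y)"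
    and sep: "\<And>i j x y. i \<in> J \<Longrightarrow> j \<in> J \<Longrightarrow> i \<noteq> j \<Longrightarrow> x \<in> F \<Longrightarrow> y \<in> F \<Longrightarrow> \<eta> \<le> dist (f i x) (f j y)"
    and sum: "1 \<le> (\<Sum>j\<in>J. p j powr s)"
  shows "ereal s \<le> upper_box_dim F"
proof (rule le_upper_box_dim[of "(\<eta> / 2) powr s"])
  fix \<delta> :: real assume d: "0 < \<delta>" "\<delta> < 1"
  \<comment> \<open>The packing is separated only weakly, whereas the comparison with covers needs
    strict separation; the doubled scale bridges this and merely changes the constant to
    \<open>(\<eta> / 2) powr s\<close>.\<close>
  obtain T where T: "finite T" "T \<subseteq> F" "(\<eta> / (2 * \<delta>)) powr s \<le> real (card T)"
    "\<And>x y. x \<in> T \<Longrightarrow> y \<in> T \<Longrightarrow> x \<noteq> y \<Longrightarrow> 2 * \<delta> \<le> dist x y"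
    by (rule separated_self_embeddings_packing[OF J F q s \<eta> into p lower sep sum, of "2 * \<delta>"])
      (use d in simp_all)
  have "card T \<le> covering_number \<delta> F"
  proof (rule card_separated_le_covering_number[OF X d(1) T(2)])
    fix x y assume "x \<in> T" "y \<in> T" "x \<noteq> y"
    from T(4)[OF this] show "\<delta> < dist x y" using d by simp
  qed
  moreover have "(\<eta> / 2) powr s * \<delta> powr (- s) = (\<eta> / (2 * \<delta>)) powr s"
    using d \<eta> by (simp add: powr_minus_divide powr_divide powr_mult)
  ultimately show "(\<eta> / 2) powr s * \<delta> powr (- s) \<le> real (covering_number \<delta> F)"
    using T(3) by linarith
qed (use \<eta> in simp)

section \<open>Words and composed maps\<close>

definition words :: "nat \<Rightarrow> nat \<Rightarrow> nat list set" where
  "words N k = {w. set w \<subseteq> {1..N} \<and> length w = k}"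

lemma finite_words [simp]: "finite (words N k)"
  unfolding words_def by (intro finite_lists_length_eq) auto

lemma words_0: "words N 0 = {[]}"
  unfolding words_def by auto

lemma words_Suc: "w \<in> words N (Suc k) \<longleftrightarrow> (\<exists>i v. w = i # v \<and> i \<in> {1..N} \<and> v \<in> words N k)"
  unfolding words_def by (cases w) auto

lemma bij_betw_append_words:
  "bij_betw (\<lambda>(v, w). v @ w) (words N k \<times> words N l) (words N (k + l))"
proof (rule bij_betw_byWitness[where f' = "\<lambda>w. (take k w, drop k w)"])
  show "(\<lambda>w. (take k w, drop k w)) ` words N (k + l) \<subseteq> words N k \<times> words N l"
    unfolding words_def by (auto dest: in_set_takeD in_set_dropD)
  show "(\<lambda>(v, w). v @ w) ` (words N k \<times> words N l) \<subseteq> words N (k + l)"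
    by (simp add: words_def image_subset_iff, blast)
qed (auto simp: words_def)

lemma word_map_Nil [simp]: "word_map S [] = id"
  by (simp add: word_map_def)

lemma word_map_Cons [simp]: "word_map S (i # w) x = S i (word_map S w x)"
  by (simp add: word_map_def)

lemma word_map_append: "word_map S (v @ w) x = word_map S v (word_map S w x)"
  by (induction v) auto

lemma word_map_in:
  assumes "(\<Union>i\<in>{1..N}. S i ` F) \<subseteq> F" "w \<in> words N k" "x \<in> F"
  shows "word_map S w x \<in> F"
  using assms(2)
proof (induction w arbitrary: k)
  case (Cons i w)
  then obtain k' where "i \<in> {1..N}" "w \<in> words N k'" unfolding words_def by auto
  then show ?case using Cons.IH assms(1) unfolding word_map_Cons by blast
qed (use assms in auto)

text \<open>The inclusion is iterated \<open>k\<close> times: a point either remains in an image of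
  \<open>F\<close> through all \<open>k\<close> letters or falls into an image of \<open>C\<close>
  after \<open>j < k\<close> of them. With \<open>C\<close> empty this covers the homogeneous case
  as well.\<close>

lemma attractor_unfold:
  assumes "F \<subseteq> (\<Union>i\<in>{1..N}. S i ` F) \<union> C"
  shows "F \<subseteq> (\<Union>w\<in>words N k. word_map S w ` F) \<union> (\<Union>j<k. \<Union>v\<in>words N j. word_map S v ` C)"
proof (induction k)
  case 0
  then show ?case by (auto simp: words_0)
next
  case (Suc k)
  show ?case
  proof
    fix x assume "x \<in> F"
    then consider i y where "i \<in> {1..N}" "y \<in> F" "x = S i y" | "x \<in> C"
      using assms by blast
    then show "x \<in> (\<Union>w\<in>words N (Suc k). word_map S w ` F) \<union>
        (\<Union>j<Suc k. \<Union>v\<in>words N j. word_map S v ` C)"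
    proof cases
      case 1
      then consider w z where "w \<in> words N k" "z \<in> F" "y = word_map S w z"
        | j v z where "j < k" "v \<in> words N j" "z \<in> C" "y = word_map S v z"
        using Suc by blast
      then show ?thesis
      proof cases
        case a: 1
        then have "i # w \<in> words N (Suc k)" "x = word_map S (i # w) z"
          using 1 by (auto simp: words_Suc)
        then show ?thesis using a by blast
      next
        case b: 2
        then have "i # v \<in> words N (Suc j)" "x = word_map S (i # v) z" "Suc j < Suc k"
          using 1 by (auto simp: words_Suc)
        then show ?thesis using b by blast
      qed
    next
      case 2
      then have "x \<in> word_map S [] ` C" "[] \<in> words N 0" by (auto simp: words_0)
      then show ?thesis by blast
    qed
  qed
qed

text \<open>At the first letter where the words differ, the images lie in disjoint sets
  \<open>S i\<close> U\<open>and\<close>S j \<open>U\<close>; the injective maps of the common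
  prefix preserve disjointness.\<close>

lemma word_map_images_disjoint:
  assumes inj: "\<And>i. i \<in> {1..N} \<Longrightarrow> inj (S i)"
    and U: "(\<Union>i\<in>{1..N}. S i ` U) \<subseteq> U" "disjoint_family_on (\<lambda>i. S i ` U) {1..N}"
    and "v \<in> words N k" "w \<in> words N k" "v \<noteq> w"
  shows "word_map S v ` U \<inter> word_map S w ` U = {}"
  using assms(4-)
proof (induction k arbitrary: v w)
  case 0
  then show ?case by (auto simp: words_0)
next
  case (Suc k)
  obtain i v' j w' where e: "v = i # v'" "i \<in> {1..N}" "v' \<in> words N k"
     "w = j # w'" "j \<in> {1..N}" "w' \<in> words N k"
    using Suc.prems by (auto simp: words_Suc)
  have im: "word_map S v ` U = S i ` word_map S v' ` U" "word_map S w ` U = S j ` word_map S w' ` U"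
    using e by auto
  show ?case
  proof (cases "i = j")
    case True
    then have "word_map S v' ` U \<inter> word_map S w' ` U = {}" using Suc e by auto
    then show ?thesis unfolding im True
      using inj[of j] e True by (metis image_Int image_empty)
  next
    case False
    have "S i ` word_map S v' ` U \<subseteq> S i ` U" "S j ` word_map S w' ` U \<subseteq> S j ` U"
      using word_map_in[OF U(1)] e by (auto intro!: image_mono)
    moreover have "S i ` U \<inter> S j ` U = {}"
      using U(2) False e unfolding disjoint_family_on_def by blast
    ultimately show ?thesis unfolding im by blast
  qed
qed

section \<open>Positive distance between disjoint compact sets\<close>

lemma compact_disjoint_separated:
  fixes A B :: "'a::metric_space set"
  assumes "compact A" "compact B" "A \<inter> B = {}"
  shows "\<exists>d>0. \<forall>x\<in>A. \<forall>y\<in>B. d \<le> dist x y"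
proof (cases "A \<times> B = {}")
  case True
  then show ?thesis by (intro exI[of _ 1]) auto
next
  case False
  have "continuous_on (A \<times> B) (\<lambda>p. dist (fst p) (snd p))"
    by (intro continuous_intros)
  from continuous_attains_inf[OF compact_Times[OF assms(1,2)] False this]
  obtain a b where ab: "a \<in> A" "b \<in> B" "\<And>x y. x \<in> A \<Longrightarrow> y \<in> B \<Longrightarrow> dist a b \<le> dist x y"
    by auto
  then have "a \<noteq> b" using assms(3) by auto
  then show ?thesis using ab by (intro exI[of _ "dist a b"]) auto
qed

lemma compact_finite_disjoint_separated:
  fixes A :: "'j \<Rightarrow> 'a::metric_space set"
  assumes "finite J" "\<And>j. j \<in> J \<Longrightarrow> compact (A j)"
    "\<And>i j. i \<in> J \<Longrightarrow> j \<in> J \<Longrightarrow> i \<noteq> j \<Longrightarrow> A i \<inter> A j = {}"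
  shows "\<exists>\<eta>>0. \<forall>i\<in>J. \<forall>j\<in>J. i \<noteq> j \<longrightarrow> (\<forall>x\<in>A i. \<forall>y\<in>A j. \<eta> \<le> dist x y)"
proof -
  define d where "d i j = (SOME d. 0 < d \<and> (\<forall>x\<in>A i. \<forall>y\<in>A j. d \<le> dist x y))" for i j
  have d: "0 < d i j \<and> (\<forall>x\<in>A i. \<forall>y\<in>A j. d i j \<le> dist x y)"
    if "i \<in> J" "j \<in> J" "i \<noteq> j" for i j
    unfolding d_def
    using someI_ex[OF compact_disjoint_separated[OF assms(2)[OF that(1)] assms(2)[OF that(2)] assms(3)[OF that]]]
    by simp
  \<comment> \<open>The inserted 1 keeps \<open>D\<close> nonempty when \<open>J\<close> has fewer
    than two elements.\<close>
  define D where "D = insert 1 ((\<lambda>(i, j). d i j) ` {(i, j). i \<in> J \<and> j \<in> J \<and> i \<noteq> j})"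
  have fin: "finite D"
    unfolding D_def
    by (intro finite.insertI finite_imageI, rule finite_subset[of _ "J \<times> J"]) (use assms(1) in auto)
  show ?thesis
  proof (intro exI[of _ "Min D"] conjI ballI impI)
    show "0 < Min D" using fin d by (subst Min_gr_iff) (auto simp: D_def)
    fix i j x y assume *: "i \<in> J" "j \<in> J" "i \<noteq> j" "x \<in> A i" "y \<in> A j"
    then have "d i j \<in> D" unfolding D_def by auto
    then have "Min D \<le> d i j" using Min_le[OF fin] by blast
    also have "\<dots> \<le> dist x y" using d * by blast
    finally show "Min D \<le> dist x y" .
  qed
qed

section \<open>Systems with distortion constant \<open>L\<close>\<close>

text \<open>For maps on at least two points, \<open>r w\<close> is the upper Lipschitz constant of \<open>word_map S w\<close> and \<open>L\<close> the
  distortion constant. One-point spaces are excluded because there the upper constants vanish.\<close>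

locale distortion_ifs =
  fixes N :: nat and S :: "nat \<Rightarrow> 'a::metric_space \<Rightarrow> 'a" and r :: "nat list \<Rightarrow> real" and L c :: real
  assumes compact_space: "compact (UNIV :: 'a set)"
    and c: "0 < c" "c < 1"
    and L: "1 \<le> L"
    and r_pos: "w \<in> words N k \<Longrightarrow> 0 < r w"
    and r_le: "w \<in> words N k \<Longrightarrow> r w \<le> c ^ k"
    and r_upper: "w \<in> words N k \<Longrightarrow> dist (word_map S w x) (word_map S w y) \<le> r w * dist x y"
    and r_lower: "w \<in> words N k \<Longrightarrow> r w * dist x y \<le> L * dist (word_map S w x) (word_map S w y)"
    and r_append: "v \<in> words N k \<Longrightarrow> w \<in> words N l \<Longrightarrow> r (v @ w) \<le> r v * r w"
begin

text \<open>This is the sum \<open>Z\<^sub>k(s)\<close> of the outline.\<close>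

definition level_sum :: "real \<Rightarrow> nat \<Rightarrow> real" where
  "level_sum s k = (\<Sum>w\<in>words N k. r w powr s)"

lemma dist_bounded: "\<exists>D>0. \<forall>x y :: 'a. dist x y \<le> D"
proof (intro exI conjI allI)
  have b: "bounded (UNIV :: 'a set)" using compact_space by (rule compact_imp_bounded)
  show "0 < diameter (UNIV :: 'a set) + 1" using diameter_ge_0[OF b] by simp
  show "dist x y \<le> diameter (UNIV :: 'a set) + 1" for x y :: 'a
    using diameter_bounded_bound[OF b, of x y] by simp
qed

lemma word_map_small:
  assumes "e > 0"
  obtains k where "\<And>w x y. w \<in> words N k \<Longrightarrow> dist (word_map S w x) (word_map S w y) < e"
proof -
  obtain D where "D > 0 \<and> (\<forall>x y :: 'a. dist x y \<le> D)" using dist_bounded by blast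
  then have D: "D > 0" "\<And>x y :: 'a. dist x y \<le> D" by simp_all
  obtain k where k: "c ^ k < e / D" using real_arch_pow_inv[of "e / D" c] c assms D(1) by auto
  show thesis
  proof (rule that[of k])
    fix w x y assume w: "w \<in> words N k"
    have "dist (word_map S w x) (word_map S w y) \<le> r w * dist x y" by (rule r_upper[OF w])
    also have "\<dots> \<le> c ^ k * D"
      using r_le[OF w] r_pos[OF w] D(2)[of x y] c by (intro mult_mono) auto
    also have "\<dots> < e" using k D(1) by (simp add: field_simps)
    finally show "dist (word_map S w x) (word_map S w y) < e" .
  qed
qed

lemma homogeneous_attractor_unfold:
  assumes "homogeneous_attractor N S F"
  shows "F \<subseteq> (\<Union>w\<in>words N k. word_map S w ` F)"
  using attractor_unfold[of F S N "{}" k] assms unfolding homogeneous_attractor_def by auto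

text \<open>A point of \<open>F\<close> is the image of some point under a long word
  \<open>w\<close>. The image under \<open>w\<close> of any point of \<open>G\<close> is close to it
  and stays in \<open>G\<close>, so closedness of \<open>G\<close> finishes the proof. This yields
  the inclusion of the homogeneous attractor in the inhomogeneous one.\<close>

lemma homogeneous_attractor_subset:
  assumes F: "homogeneous_attractor N S F"
    and G: "closed G" "G \<noteq> {}" "(\<Union>i\<in>{1..N}. S i ` G) \<subseteq> G"
  shows "F \<subseteq> G"
proof
  fix x assume x: "x \<in> F"
  obtain y where y: "y \<in> G" using G by blast
  have "x \<in> closure G"
    unfolding closure_approachable
  proof (intro allI impI)
    fix e :: real assume "0 < e"
    then obtain k where k: "\<And>w x y. w \<in> words N k \<Longrightarrow> dist (word_map S w x) (word_map S w y) < e"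
      using word_map_small by blast
    obtain w z where w: "w \<in> words N k" "x = word_map S w z"
      using homogeneous_attractor_unfold[OF F, of k] x by blast
    have "word_map S w y \<in> G" by (rule word_map_in[OF G(3) w(1) y])
    then show "\<exists>y\<in>G. dist y x < e" using k[OF w(1)] w(2) by blast
  qed
  then show "x \<in> G" using G(1) by simp
qed

lemma piece_in_open:
  assumes F: "homogeneous_attractor N S F" and U: "open U" "F \<inter> U \<noteq> {}"
  obtains k u where "u \<in> words N k" "word_map S u ` F \<subseteq> U"
proof -
  obtain x where x: "x \<in> F" "x \<in> U" using U by blast
  obtain e where e: "e > 0" "ball x e \<subseteq> U" using U(1) x(2) open_contains_ball by blast
  obtain k where k: "\<And>w x y. w \<in> words N k \<Longrightarrow> dist (word_map S w x) (word_map S w y) < e"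
    using word_map_small[OF e(1)] by blast
  obtain u z where u: "u \<in> words N k" "x = word_map S u z"
    using homogeneous_attractor_unfold[OF F, of k] x by blast
  have "word_map S u ` F \<subseteq> ball x e" using k[OF u(1)] u(2) by auto
  then show thesis using that u(1) e(2) by blast
qed

lemma inj_S:
  assumes "i \<in> {1..N}"
  shows "inj (S i)"
proof (rule injI)
  fix x y assume eq: "S i x = S i y"
  have w: "[i] \<in> words N 1" using assms by (simp add: words_def)
  have "r [i] * dist x y \<le> 0" using r_lower[OF w, of x y] eq by simp
  then show "x = y" using r_pos[OF w] by (simp add: mult_le_0_iff)
qed

text \<open>The self-embeddings are the maps of the words \<open>w @ u\<close> with \<open>w\<close>
  of length \<open>k\<close> and a fixed \<open>u\<close> that pushes \<open>F\<close> into
  \<open>U\<close>. Their ratios lose a factor \<open>a\<close> that does not depend on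
  \<open>k\<close>, and a large \<open>k\<close> makes up for it.\<close>

lemma exists_level_sum_less_1:
  assumes F: "homogeneous_attractor N S F" and sosc: "strong_open_set_condition N S F"
    and s: "upper_box_dim F < ereal s"
  shows "\<exists>k>0. level_sum s k < 1"
proof (rule ccontr)
  assume "\<not> ?thesis"
  then have ge1: "1 \<le> level_sum s k" if "k > 0" for k
    using that by (meson not_less)
  have F': "F \<noteq> {}" "compact F" "(\<Union>i\<in>{1..N}. S i ` F) \<subseteq> F"
    using F unfolding homogeneous_attractor_def by auto
  have "0 \<le> upper_box_dim F" by (rule upper_box_dim_nonneg[OF compact_space F'(1)])
  \<comment> \<open>The contradiction will be that the dimension is at least \<open>t\<close>; the
    gap \<open>s - t\<close> is what absorbs the factor \<open>a\<close>.\<close>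
  obtain t where t: "upper_box_dim F < ereal t" "t < s"
    using ereal_dense2[OF s] by auto
  have t0: "0 < t" using \<open>0 \<le> upper_box_dim F\<close> t(1)
    by (metis ereal_less(2) le_less_trans)
  obtain U where U: "open U" "F \<inter> U \<noteq> {}" "(\<Union>i\<in>{1..N}. S i ` U) \<subseteq> U"
      "disjoint_family_on (\<lambda>i. S i ` U) {1..N}"
    using sosc unfolding strong_open_set_condition_def by blast
  obtain m u where u: "u \<in> words N m" "word_map S u ` F \<subseteq> U"
    using piece_in_open[OF F U(1,2)] .
  \<comment> \<open>Applying \<open>r_lower\<close> to \<open>w\<close> and to \<open>u\<close>
    costs \<open>L\<close> each time, so \<open>r w * a\<close> is a lower ratio for the
    composition.\<close>
  define a where "a = r u / L\<^sup>2"
  have a: "0 < a" "a \<le> 1"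
  proof -
    show "0 < a" using r_pos[OF u(1)] L by (simp add: a_def)
    have "r u \<le> 1" using r_le[OF u(1)] c power_le_one[of c m] by linarith
    moreover have "1 \<le> L\<^sup>2" using L by simp
    ultimately show "a \<le> 1" unfolding a_def by (simp add: divide_le_eq)
  qed
  \<comment> \<open>For words of length \<open>k\<close>, \<open>r w powr (s - t)\<close> is at most
    \<open>(c powr (s - t)) ^ k\<close>. Once this is below \<open>a powr t\<close>, the sum of the
    \<open>(r w * a) powr t\<close> dominates \<open>level_sum s k\<close>, which is at least
    1.\<close>
  have "0 < a powr t" "c powr (s - t) < 1"
    using a c t(2) powr_less_mono2[of "s - t" c 1] by auto
  then obtain n where n: "(c powr (s - t)) ^ n < a powr t"
    using real_arch_pow_inv by blast
  \<comment> \<open>The length must be positive, both for \<open>ge1\<close> and to bound all ratios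
    by \<open>c < 1\<close>.\<close>
  define k where "k = Suc n"
  have k: "(c powr (s - t)) ^ k \<le> a powr t"
  proof -
    have "(c powr (s - t)) ^ k \<le> (c powr (s - t)) ^ n"
      using \<open>c powr (s - t) < 1\<close> by (intro power_decreasing) (auto simp: k_def)
    with n show ?thesis by simp
  qed
  let ?f = "\<lambda>w x. word_map S w (word_map S u x)"
  have "ereal t \<le> upper_box_dim F"
  proof -
    have cont: "continuous_on F (?f w)" if w: "w \<in> words N k" for w
    proof -
      have "(r w)-lipschitz_on UNIV (word_map S w)" "(r u)-lipschitz_on UNIV (word_map S u)"
        using r_upper r_pos u(1) w by (auto intro!: lipschitz_onI intro: less_imp_le)
      then have "continuous_on UNIV (word_map S w)" "continuous_on UNIV (word_map S u)"
        by (auto intro: lipschitz_on_continuous_on)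
      then show ?thesis
        using continuous_on_compose2[of UNIV "word_map S w" F "word_map S u"]
        by (simp add: continuous_on_subset[OF _ subset_UNIV])
    qed
    have compact: "compact (?f w ` F)" if "w \<in> words N k" for w
      using cont[OF that] F'(2) by (rule compact_continuous_image)
    \<comment> \<open>This is where the choice of \<open>u\<close> enters: the images of
      \<open>U\<close> under distinct words of equal length are disjoint, and the piece of
      \<open>u\<close> lies in \<open>U\<close>.\<close>
    have disjoint: "?f v ` F \<inter> ?f w ` F = {}" if "v \<in> words N k" "w \<in> words N k" "v \<noteq> w" for v w
    proof -
      have "?f v ` F \<subseteq> word_map S v ` U" "?f w ` F \<subseteq> word_map S w ` U" using u(2) by auto
      then show ?thesis using word_map_images_disjoint[OF inj_S U(3,4) that] by blast
    qed
    obtain \<eta> where \<eta>: "0 < \<eta>" "\<forall>v\<in>words N k. \<forall>w\<in>words N k. v \<noteq> w \<longrightarrow>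
        (\<forall>x\<in>?f v ` F. \<forall>y\<in>?f w ` F. \<eta> \<le> dist x y)"
      using compact_finite_disjoint_separated[of "words N k" "\<lambda>w. ?f w ` F", OF finite_words compact disjoint]
      by blast
    show ?thesis
    proof (rule separated_self_embeddings_upper_box_dim[OF compact_space finite_words[of N k] F'(1)
          _ _ _ \<eta>(1), where f = ?f and p = "\<lambda>w. r w * a" and q = c])
      fix w assume w: "w \<in> words N k"
      show "?f w x \<in> F" if "x \<in> F" for x
        using word_map_in[OF F'(3)] u(1) w that by blast
      show "0 < r w * a" using r_pos[OF w] a by simp
      have "r w * a \<le> r w * 1" using r_pos[OF w] a by (intro mult_left_mono) auto
      also have "\<dots> \<le> c * c ^ n" using r_le[OF w] by (simp add: k_def)
      also have "\<dots> \<le> c * 1" using c power_le_one[of c n] by (intro mult_left_mono) auto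
      finally show "r w * a \<le> c" by simp
      show "r w * a * dist x y \<le> dist (?f w x) (?f w y)" for x y
      proof -
        have "r w * (r u * dist x y) \<le> r w * (L * dist (word_map S u x) (word_map S u y))"
          using r_lower[OF u(1)] r_pos[OF w] by (intro mult_left_mono) auto
        also have "\<dots> = L * (r w * dist (word_map S u x) (word_map S u y))" by simp
        also have "\<dots> \<le> L * (L * dist (?f w x) (?f w y))"
          using r_lower[OF w] L by (intro mult_left_mono) auto
        finally show ?thesis using L by (simp add: a_def field_simps power2_eq_square)
      qed
    next
      show "\<eta> \<le> dist (?f v x) (?f w y)"
        if "v \<in> words N k" "w \<in> words N k" "v \<noteq> w" "x \<in> F" "y \<in> F" for v w x y
        using \<eta>(2) that by blast
      have "1 \<le> level_sum s k" by (rule ge1) (simp add: k_def)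
      also have "\<dots> = (\<Sum>w\<in>words N k. r w powr t * r w powr (s - t))"
        unfolding level_sum_def by (simp add: powr_add[symmetric])
      also have "\<dots> \<le> (\<Sum>w\<in>words N k. r w powr t * a powr t)"
      proof (intro sum_mono mult_left_mono)
        fix w assume w: "w \<in> words N k"
        have "r w powr (s - t) \<le> (c ^ k) powr (s - t)"
          using r_le[OF w] r_pos[OF w] t by (intro powr_mono2) auto
        also have "\<dots> = (c powr (s - t)) ^ k"
          using c by (simp add: powr_realpow[symmetric] powr_powr mult.commute)
        finally show "r w powr (s - t) \<le> a powr t" using k by simp
      qed simp
      also have "\<dots> = (\<Sum>w\<in>words N k. (r w * a) powr t)"
        using r_pos a by (intro sum.cong refl) (simp add: powr_mult less_imp_le)
      finally show "1 \<le> (\<Sum>w\<in>words N k. (r w * a) powr t)" .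
    qed (use c t0 in auto)
  qed
  with t(1) show False by simp
qed

text \<open>Each word of length \<open>k + l\<close> splits uniquely into a prefix and a suffix, and
  \<open>r\<close> is submultiplicative under concatenation.\<close>

lemma level_sum_add_le:
  assumes "0 \<le> s"
  shows "level_sum s (k + l) \<le> level_sum s k * level_sum s l"
proof -
  have "level_sum s (k + l) = (\<Sum>(v, w)\<in>words N k \<times> words N l. r (v @ w) powr s)"
    unfolding level_sum_def
    by (subst sum.reindex_bij_betw[OF bij_betw_append_words, symmetric]) (simp add: case_prod_unfold)
  also have "\<dots> \<le> (\<Sum>(v, w)\<in>words N k \<times> words N l. r v powr s * r w powr s)"
  proof (intro sum_mono, clarify)
    fix v w assume vw: "v \<in> words N k" "w \<in> words N l"
    have "v @ w \<in> words N (k + l)" using bij_betw_apply[OF bij_betw_append_words] vw by force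
    then have "r (v @ w) powr s \<le> (r v * r w) powr s"
      using r_append[OF vw] r_pos assms by (intro powr_mono2) (auto intro: less_imp_le)
    then show "r (v @ w) powr s \<le> r v powr s * r w powr s"
      using r_pos vw by (simp add: powr_mult less_imp_le)
  qed
  also have "\<dots> = level_sum s k * level_sum s l"
    unfolding level_sum_def sum_product by (simp add: sum.cartesian_product)
  finally show ?thesis .
qed

text \<open>Shifting the index by \<open>k\<close> costs a factor of at most \<open>z < 1\<close>,
  so a partial sum \<open>G\<close> satisfies \<open>G \<le> B0 + z * G\<close>, which can be solved
  for \<open>G\<close>.\<close>

lemma level_sum_partial_sums_bounded:
  assumes s: "0 \<le> s" and k: "level_sum s k < 1"
  obtains B where "0 \<le> B" "\<And>n. (\<Sum>j<n. level_sum s j) \<le> B"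
proof -
  have nonneg: "0 \<le> level_sum s j" for j unfolding level_sum_def by (simp add: sum_nonneg)
  define z where "z = level_sum s k"
  define B0 where "B0 = (\<Sum>j<k. level_sum s j)"
  show thesis
  proof (rule that[of "B0 / (1 - z)"])
    show "0 \<le> B0 / (1 - z)" using k nonneg by (auto simp: B0_def z_def sum_nonneg)
    fix n
    define G where "G = (\<Sum>j<n. level_sum s j)"
    have "G \<le> (\<Sum>j<k + n. level_sum s j)"
      unfolding G_def by (intro sum_mono2) (auto simp: nonneg)
    also have "\<dots> = B0 + (\<Sum>j<n. level_sum s (k + j))"
      unfolding B0_def by (induction n) auto
    also have "\<dots> \<le> B0 + (\<Sum>j<n. z * level_sum s j)"
      unfolding z_def using s by (intro add_left_mono sum_mono level_sum_add_le)
    also have "\<dots> = B0 + z * G" by (simp add: G_def sum_distrib_left)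
    finally have "G * (1 - z) \<le> B0" by (simp add: algebra_simps)
    then show "(\<Sum>j<n. level_sum s j) \<le> B0 / (1 - z)"
      using k by (simp add: G_def z_def pos_le_divide_eq)
  qed
qed

text \<open>At each scale a cover of \<open>FC\<close> is centred at \<open>E\<close>: the centres
  of a cover of \<open>F0\<close>, and the images of centres covering \<open>C\<close> at rescaled
  sizes. Its cardinality is controlled by the bounded sum of all
  \<open>level_sum s j\<close>.\<close>

lemma upper_box_dim_attractor_le:
  assumes F0: "homogeneous_attractor N S F0" and FC: "inhomogeneous_attractor N S C FC"
    and C: "C \<noteq> {}"
    and dimF: "upper_box_dim F0 < ereal s" and dimC: "upper_box_dim C < ereal s"
    and k: "level_sum s k < 1"
  shows "upper_box_dim FC \<le> ereal s"
proof -
  have F0': "F0 \<noteq> {}" "(\<Union>i\<in>{1..N}. S i ` F0) \<subseteq> F0"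
    using F0 unfolding homogeneous_attractor_def by auto
  have FC': "FC \<noteq> {}" "FC \<subseteq> (\<Union>i\<in>{1..N}. S i ` FC) \<union> C"
    using FC unfolding inhomogeneous_attractor_def by auto
  have s: "0 < s"
    using upper_box_dim_nonneg[OF compact_space C] dimC by (metis ereal_less(2) le_less_trans)
  obtain K0 where K0: "K0 > 0"
      "\<And>\<delta>. 0 < \<delta> \<Longrightarrow> \<delta> \<le> 1 \<Longrightarrow> real (covering_number \<delta> F0) \<le> K0 * \<delta> powr (- s)"
    using covering_number_bound_of_upper_box_dim_less[OF compact_space F0'(1) dimF] by blast
  obtain K1 where K1: "K1 > 0"
      "\<And>\<delta>. 0 < \<delta> \<Longrightarrow> \<delta> \<le> 1 \<Longrightarrow> real (covering_number \<delta> C) \<le> K1 * \<delta> powr (- s)"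
    using covering_number_bound_of_upper_box_dim_less[OF compact_space C dimC] by blast
  obtain B where B: "0 \<le> B" "\<And>n. (\<Sum>j<n. level_sum s j) \<le> B"
    using level_sum_partial_sums_bounded[OF less_imp_le[OF s] k] by blast
  obtain D where "D > 0 \<and> (\<forall>x y :: 'a. dist x y \<le> D)" using dist_bounded by blast
  then have D: "D > 0" "\<And>x y :: 'a. dist x y \<le> D" by simp_all
  obtain x0 where x0: "x0 \<in> F0" using F0' by blast
  show ?thesis
  proof (rule upper_box_dim_le[OF compact_space FC'(1), of "K0 + K1 * B" "1 + 2 * D"])
    fix \<delta> :: real assume \<delta>: "0 < \<delta>" "\<delta> < 1"
    \<comment> \<open>Every word of length \<open>n\<close> then has \<open>r w < \<delta>\<close>,
      so unfolding \<open>FC\<close> to depth \<open>n\<close> leaves only small images of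
      \<open>FC\<close> itself.\<close>
    obtain n where n: "c ^ n < \<delta>" using real_arch_pow_inv[of \<delta> c] \<delta> c by blast
    define W where "W = (\<Union>j<n. words N j)"
    \<comment> \<open>These words need their own covers of \<open>C\<close>;
      \<open>\<delta> \<le> r v\<close> keeps the scale \<open>\<delta> / r v\<close> in the range
      where the bound with \<open>K1\<close> holds.\<close>
    define V where "V = {v \<in> W. \<delta> \<le> r v}"
    have W: "finite W" unfolding W_def by auto
    then have V: "finite V" unfolding V_def by auto
    have rV: "0 < r v" "0 < \<delta> / r v" "\<delta> / r v \<le> 1" if "v \<in> V" for v
      using that \<delta> r_pos by (auto simp: V_def W_def divide_le_eq)
    obtain T0 where T0: "finite T0" "card T0 = covering_number \<delta> F0" "F0 \<subseteq> (\<Union>x\<in>T0. cball x (\<delta> / 2))"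
      using covering_number_attained[OF compact_space \<delta>(1)] .
    have "\<forall>v\<in>V. \<exists>T. finite T \<and> card T = covering_number (\<delta> / r v) C \<and> C \<subseteq> (\<Union>x\<in>T. cball x (\<delta> / r v / 2))"
    proof
      fix v assume "v \<in> V"
      show "\<exists>T. finite T \<and> card T = covering_number (\<delta> / r v) C \<and> C \<subseteq> (\<Union>x\<in>T. cball x (\<delta> / r v / 2))"
        by (rule covering_number_attained[OF compact_space rV(2)[OF \<open>v \<in> V\<close>], of C]) blast
    qed
    from bchoice[OF this] obtain T where "\<forall>v\<in>V. finite (T v) \<and>
        card (T v) = covering_number (\<delta> / r v) C \<and> C \<subseteq> (\<Union>x\<in>T v. cball x (\<delta> / r v / 2))" ..
    then have T: "finite (T v)" "card (T v) = covering_number (\<delta> / r v) C"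
        "C \<subseteq> (\<Union>x\<in>T v. cball x (\<delta> / r v / 2))" if "v \<in> V" for v
      using that by blast+
    define E where "E = T0 \<union> (\<Union>v\<in>V. word_map S v ` T v)"
    have E: "finite E" unfolding E_def using T0 T V by auto
    let ?R = "(1 + 2 * D) * \<delta> / 2"
    \<comment> \<open>The image of the whole space under such a word has diameter at most
      \<open>\<delta> * D\<close> and meets \<open>F0\<close>, so the cover of \<open>F0\<close>
      reaches it once its balls are enlarged to radius \<open>?R\<close>.\<close>
    have short: "\<exists>t\<in>E. dist t (word_map S w z) \<le> ?R"
      if w: "w \<in> words N j" "r w < \<delta>" for w j z
    proof -
      have "word_map S w x0 \<in> F0" by (rule word_map_in[OF F0'(2) w(1) x0])
      then obtain t where t: "t \<in> T0" "dist t (word_map S w x0) \<le> \<delta> / 2" using T0(3) by force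
      have "dist (word_map S w x0) (word_map S w z) \<le> r w * dist x0 z" by (rule r_upper[OF w(1)])
      also have "\<dots> \<le> \<delta> * D" using w(2) r_pos[OF w(1)] D(2)[of x0 z] by (intro mult_mono) auto
      finally have "dist t (word_map S w z) \<le> \<delta> / 2 + \<delta> * D"
        using t(2) dist_triangle[of t "word_map S w z" "word_map S w x0"] by linarith
      also have "\<dots> = ?R" by (simp add: field_simps)
      finally show ?thesis using t(1) unfolding E_def by blast
    qed
    have "FC \<subseteq> (\<Union>t\<in>E. cball t ?R)"
    proof
      fix x assume "x \<in> FC"
      then consider w z where "w \<in> words N n" "x = word_map S w z"
        | j v z where "j < n" "v \<in> words N j" "z \<in> C" "x = word_map S v z"
        using attractor_unfold[OF FC'(2), of n] by blast
      then have "\<exists>t\<in>E. dist t x \<le> ?R"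
      proof cases
        case 1
        then show ?thesis using short[of w n z] r_le[of w n] n by auto
      next
        case 2
        show ?thesis
        proof (cases "r v < \<delta>")
          case True
          then show ?thesis using short[of v j z] 2 by auto
        next
          case False
          then have v: "v \<in> V" using 2 unfolding V_def W_def by auto
          then obtain t where t: "t \<in> T v" "dist t z \<le> \<delta> / r v / 2" using T(3)[OF v] 2 by force
          have "dist (word_map S v t) x \<le> r v * dist t z" using r_upper[OF 2(2)] 2(4) by simp
          also have "\<dots> \<le> r v * (\<delta> / r v / 2)" using t rV(1)[OF v] by (intro mult_left_mono) auto
          also have "\<dots> = \<delta> / 2" using rV(1)[OF v] by simp
          also have "\<dots> \<le> ?R" using D(1) \<delta> by (simp add: field_simps)
          finally show ?thesis using t(1) v unfolding E_def by blast
        qed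
      qed
      then show "x \<in> (\<Union>t\<in>E. cball t ?R)" by simp
    qed
    then have "real (covering_number ((1 + 2 * D) * \<delta>) FC) \<le> real (card E)"
      using covering_number_le[OF E] by simp
    also have "\<dots> \<le> real (card T0 + (\<Sum>v\<in>V. card (T v)))"
    proof -
      have "card (\<Union>v\<in>V. word_map S v ` T v) \<le> (\<Sum>v\<in>V. card (word_map S v ` T v))"
        by (rule card_UN_le[OF V])
      also have "\<dots> \<le> (\<Sum>v\<in>V. card (T v))" by (intro sum_mono card_image_le T)
      finally show ?thesis unfolding E_def using card_Un_le[of T0] by (meson add_left_mono le_trans of_nat_mono)
    qed
    also have "\<dots> \<le> K0 * \<delta> powr (- s) + (\<Sum>v\<in>V. K1 * (\<delta> / r v) powr (- s))"
      using K0(2)[of \<delta>] K1(2)[OF rV(2,3)] \<delta> by (auto simp: T0 T intro!: add_mono sum_mono)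
    also have "(\<Sum>v\<in>V. K1 * (\<delta> / r v) powr (- s)) = K1 * \<delta> powr (- s) * (\<Sum>v\<in>V. r v powr s)"
      unfolding sum_distrib_left
      using rV \<delta> by (intro sum.cong refl) (simp add: powr_minus_divide powr_divide less_imp_le)
    \<comment> \<open>The bound is independent of \<open>n\<close>, hence of
      \<open>\<delta>\<close>.\<close>
    also have "(\<Sum>v\<in>V. r v powr s) \<le> B"
    proof -
      have "(\<Sum>v\<in>V. r v powr s) \<le> (\<Sum>v\<in>W. r v powr s)"
        by (intro sum_mono2 W) (auto simp: V_def)
      also have "\<dots> = (\<Sum>j<n. level_sum s j)"
        unfolding W_def level_sum_def by (rule sum.UNION_disjoint, simp, simp, auto simp: words_def)
      finally show ?thesis using B(2)[of n] by linarith
    qed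
    finally show "real (covering_number ((1 + 2 * D) * \<delta>) FC) \<le> (K0 + K1 * B) * \<delta> powr (- s)"
      using K1(1) \<delta> by (simp add: algebra_simps mult_left_mono)
  qed (use K0 K1 B D in \<open>auto intro!: add_pos_nonneg\<close>)
qed

theorem upper_box_dim_inhomogeneous_attractor:
  assumes F0: "homogeneous_attractor N S F0" and FC: "inhomogeneous_attractor N S C FC"
    and C: "C \<noteq> {}" and sosc: "strong_open_set_condition N S F0"
  shows "upper_box_dim FC = max (upper_box_dim F0) (upper_box_dim C)"
proof (rule antisym)
  have F0': "F0 \<noteq> {}" using F0 unfolding homogeneous_attractor_def by auto
  have FC': "FC \<noteq> {}" "closed FC" "(\<Union>i\<in>{1..N}. S i ` FC) \<subseteq> FC" "C \<subseteq> FC"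
    using FC unfolding inhomogeneous_attractor_def by (auto intro: compact_imp_closed)
  have "F0 \<subseteq> FC" by (rule homogeneous_attractor_subset[OF F0 FC'(2,1,3)])
  then show "max (upper_box_dim F0) (upper_box_dim C) \<le> upper_box_dim FC"
    using upper_box_dim_mono[OF compact_space] F0' C FC'(4) by simp
  show "upper_box_dim FC \<le> max (upper_box_dim F0) (upper_box_dim C)"
  proof (rule dense_ge)
    \<comment> \<open>Only a real \<open>z\<close> needs an argument: it exceeds both dimensions and
      serves as the exponent \<open>s\<close>.\<close>
    fix z assume z: "max (upper_box_dim F0) (upper_box_dim C) < z"
    show "upper_box_dim FC \<le> z"
    proof (cases z)
      case (real s)
      then have dim: "upper_box_dim F0 < ereal s" "upper_box_dim C < ereal s" using z by auto
      obtain k where "level_sum s k < 1" using exists_level_sum_less_1[OF F0 sosc dim(1)] by blast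
      then show ?thesis using upper_box_dim_attractor_le[OF F0 FC C dim] real by simp
    next
      case PInf
      then show ?thesis by simp
    next
      case MInf
      then show ?thesis using z by simp
    qed
  qed
qed

end

section \<open>Real Lipschitz constants from bounded distortion\<close>

lemma Lip_upper_le:
  assumes "\<And>x y. dist (f x) (f y) \<le> b * dist x y"
  shows "Lip_upper f \<le> ennreal b"
  unfolding Lip_upper_def using assms
  by (auto intro!: SUP_least ennreal_leI simp: divide_le_eq)

lemma ratio_le_Lip_upper: "x \<noteq> y \<Longrightarrow> ennreal (dist (f x) (f y) / dist x y) \<le> Lip_upper f"
  unfolding Lip_upper_def by (rule SUP_upper2[of "(x, y)"]) auto

lemma Lip_lower_le_ratio: "x \<noteq> y \<Longrightarrow> Lip_lower f \<le> ennreal (dist (f x) (f y) / dist x y)"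
  unfolding Lip_lower_def by (rule INF_lower2[of "(x, y)"]) auto

lemma dist_le_Lip_upper:
  assumes "Lip_upper f < top"
  shows "dist (f x) (f y) \<le> enn2real (Lip_upper f) * dist x y"
proof (cases "x = y")
  case False
  have "dist (f x) (f y) / dist x y \<le> enn2real (Lip_upper f)"
    using ratio_le_Lip_upper[OF False, of f] assms enn2real_mono by fastforce
  then show ?thesis using False by (simp add: divide_le_eq)
qed simp

text \<open>The ratio bound says that the upper constant is at most \<open>L\<close> times the lower
  one. A single pair \<open>x \<noteq> y\<close> makes the lower constant finite, so the division
  can be carried out in the reals.\<close>

lemma Lip_upper_mult_dist_le:
  assumes fin: "Lip_upper f < top" and pos: "0 < Lip_lower f"
    and ratio: "Lip_upper f / Lip_lower f < ennreal L" and "0 \<le> L"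
  shows "enn2real (Lip_upper f) * dist x y \<le> L * dist (f x) (f y)"
proof (cases "x = y")
  case False
  define l where "l = enn2real (Lip_lower f)"
  define u where "u = enn2real (Lip_upper f)"
  have "Lip_lower f < top" using Lip_lower_le_ratio[OF False, of f] by (rule le_less_trans) simp
  then have l: "Lip_lower f = ennreal l" "0 < l"
    using pos by (auto simp: l_def enn2real_positive_iff)
  have u: "Lip_upper f = ennreal u" "0 \<le> u" using fin by (auto simp: u_def)
  have "ennreal (u / l) < ennreal L" using ratio u l by (simp add: divide_ennreal)
  then have "u / l < L" using u l by (simp add: ennreal_less_iff)
  then have "u \<le> L * l" using l by (simp add: divide_less_eq)
  moreover have "l \<le> dist (f x) (f y) / dist x y"
    using Lip_lower_le_ratio[OF False, of f] l by simp
  then have "l * dist x y \<le> dist (f x) (f y)" using False by (simp add: le_divide_eq)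
  then have "L * (l * dist x y) \<le> L * dist (f x) (f y)" using assms(4) by (rule mult_left_mono)
  ultimately show ?thesis
    using mult_right_mono[of u "L * l" "dist x y"] by (simp add: u_def mult.assoc)
qed simp

lemma ifs_uniform_contraction:
  assumes "ifs N S"
  obtains c where "0 < c" "c < 1" "\<And>i. i \<in> {1..N} \<Longrightarrow> c-lipschitz_on UNIV (S i)"
proof -
  have "\<forall>i\<in>{1..N}. \<exists>b<1. b-lipschitz_on UNIV (S i)"
    using assms unfolding ifs_def contraction_def by auto
  then obtain b where b: "\<And>i. i \<in> {1..N} \<Longrightarrow> b i < 1" "\<And>i. i \<in> {1..N} \<Longrightarrow> (b i)-lipschitz_on UNIV (S i)"
    by metis
  \<comment> \<open>The inserted \<open>1/2\<close> ensures \<open>0 < c\<close>, even if all the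
    \<open>b i\<close> vanish.\<close>
  define c where "c = Max (insert (1/2) (b ` {1..N}))"
  have "1/2 \<le> c" "\<And>i. i \<in> {1..N} \<Longrightarrow> b i \<le> c" unfolding c_def by (intro Max_ge; simp)+
  moreover have "c < 1" unfolding c_def using b(1) by (subst Max_less_iff) auto
  ultimately show thesis using b(2) by (intro that[of c]) (auto intro: lipschitz_on_le)
qed

lemma word_map_contracts:
  assumes "0 \<le> c" "\<And>i. i \<in> {1..N} \<Longrightarrow> c-lipschitz_on UNIV (S i)" "w \<in> words N k"
  shows "dist (word_map S w x) (word_map S w y) \<le> c ^ k * dist x y"
  using assms(3)
proof (induction k arbitrary: w)
  case 0
  then show ?case by (simp add: words_0)
next
  case (Suc k)
  then obtain i v where v: "w = i # v" "i \<in> {1..N}" "v \<in> words N k" by (auto simp: words_Suc)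
  have "dist (word_map S w x) (word_map S w y) \<le> c * dist (word_map S v x) (word_map S v y)"
    using lipschitz_onD[OF assms(2)[OF v(2)]] v(1) by simp
  also have "\<dots> \<le> c * (c ^ k * dist x y)"
    using Suc.IH[OF v(3)] assms(1) by (rule mult_left_mono)
  finally show ?case by simp
qed

lemma distortion_ifs_of_bounded_distortion:
  fixes S :: "nat \<Rightarrow> 'a::metric_space \<Rightarrow> 'a" and a b :: 'a
  assumes X: "compact (UNIV :: 'a set)" and ifs: "ifs N S" and bd: "bounded_distortion N S"
    and ab: "a \<noteq> b"
  obtains L c where "distortion_ifs N S (\<lambda>w. enn2real (Lip_upper (word_map S w))) L c"
proof -
  obtain c where c: "0 < c" "c < 1" "\<And>i. i \<in> {1..N} \<Longrightarrow> c-lipschitz_on UNIV (S i)"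
    using ifs_uniform_contraction[OF ifs] by blast
  obtain L where L: "1 < L" "\<And>w. w \<in> lists {1..N} \<Longrightarrow> w \<noteq> [] \<Longrightarrow> 0 < Lip_lower (word_map S w)"
      "\<And>w. w \<in> lists {1..N} \<Longrightarrow> w \<noteq> [] \<Longrightarrow>
        Lip_upper (word_map S w) / Lip_lower (word_map S w) < ennreal L"
    using bd unfolding bounded_distortion_def by blast
  let ?r = "\<lambda>w. enn2real (Lip_upper (word_map S w))"
  have le: "Lip_upper (word_map S w) \<le> ennreal (c ^ k)" if "w \<in> words N k" for w k
    by (rule Lip_upper_le, rule word_map_contracts[OF _ c(3) that]) (use c in auto)
  have fin: "Lip_upper (word_map S w) < top" if "w \<in> words N k" for w k
    using le[OF that] by (rule le_less_trans) simp
  have lists: "w \<in> lists {1..N}" if "w \<in> words N k" for w k using that by (auto simp: words_def)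
  have upper: "dist (word_map S w x) (word_map S w y) \<le> ?r w * dist x y" if "w \<in> words N k" for w k x y
    by (rule dist_le_Lip_upper[OF fin[OF that]])
  have r_le: "?r w \<le> c ^ k" if "w \<in> words N k" for w k
    using le[OF that] c by (intro enn2real_leI) auto
  have lower: "?r w * dist x y \<le> L * dist (word_map S w x) (word_map S w y)"
    if w: "w \<in> words N k" for w k x y
  proof (cases "w = []")
    \<comment> \<open>\<open>bounded_distortion\<close> speaks of nonempty words only. The empty
      word gives the identity, with constant at most \<open>1 < L\<close>.\<close>
    case True
    then have "?r w \<le> L" using r_le[OF w] w L by (simp add: words_def)
    then show ?thesis using True by (simp add: mult_right_mono)
  next
    case False
    show ?thesis
      using L lists[OF w] False by (intro Lip_upper_mult_dist_le fin[OF w]) auto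
  qed
  have pos: "0 < ?r w" if w: "w \<in> words N k" for w k
  proof (cases "w = []")
    \<comment> \<open>The identity has ratio 1 on the pair \<open>a\<close>,
      \<open>b\<close>.\<close>
    case True
    then show ?thesis using ratio_le_Lip_upper[OF ab, of "word_map S w"] ab fin[OF w]
      by (auto simp: enn2real_positive_iff intro: less_le_trans[of 0 1])
  next
    case False
    have "0 < Lip_lower (word_map S w)" using L(2) lists[OF w] False by blast
    also have "\<dots> \<le> Lip_upper (word_map S w)"
      using Lip_lower_le_ratio[OF ab] ratio_le_Lip_upper[OF ab] by (rule order_trans)
    finally show ?thesis using fin[OF w] by (simp add: enn2real_positive_iff)
  qed
  have append: "?r (v @ w) \<le> ?r v * ?r w" if vw: "v \<in> words N k" "w \<in> words N l" for v w k l
  proof (rule enn2real_leI[OF _ Lip_upper_le])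
    fix x y
    have "dist (word_map S (v @ w) x) (word_map S (v @ w) y)
        \<le> ?r v * dist (word_map S w x) (word_map S w y)"
      using upper[OF vw(1)] by (simp add: word_map_append)
    also have "\<dots> \<le> ?r v * (?r w * dist x y)" by (intro mult_left_mono upper[OF vw(2)]) simp
    finally show "dist (word_map S (v @ w) x) (word_map S (v @ w) y) \<le> ?r v * ?r w * dist x y"
      by (simp add: mult.assoc)
  qed simp
  have "distortion_ifs N S ?r L c"
    by unfold_locales (use X c L(1) pos r_le upper lower append in \<open>blast intro: less_imp_le\<close>)+
  then show thesis by (rule that)
qed

theorem corollary2p2:
  fixes S :: "nat \<Rightarrow> 'a::metric_space \<Rightarrow> 'a" and N :: nat and C F0 FC :: "'a set"
  assumes "compact (UNIV :: 'a set)"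
    and "ifs N S"
    and "bounded_distortion N S"
    and "compact C" and "C \<noteq> {}"
    and "homogeneous_attractor N S F0"
    and "inhomogeneous_attractor N S C FC"
    and "strong_open_set_condition N S F0"
  shows "upper_box_dim FC = max (upper_box_dim F0) (upper_box_dim C)"
proof (cases "\<exists>a b :: 'a. a \<noteq> b")
  case True
  then obtain a b :: 'a where "a \<noteq> b" by blast
  then obtain L c where "distortion_ifs N S (\<lambda>w. enn2real (Lip_upper (word_map S w))) L c"
    using distortion_ifs_of_bounded_distortion assms(1-3) by blast
  from distortion_ifs.upper_box_dim_inhomogeneous_attractor[OF this assms(6,7,5,8)] show ?thesis .
next
  case False
  \<comment> \<open>Without two distinct points every nonempty set is the whole space, so all three
    dimensions agree.\<close>
  then have univ: "A = UNIV" if ne: "A \<noteq> {}" for A :: "'a set"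
  proof -
    obtain x where "x \<in> A" using ne by blast
    moreover have "y = x" for y using False by simp
    ultimately show ?thesis by (metis UNIV_eq_I)
  qed
  have "F0 \<noteq> {}" "FC \<noteq> {}"
    using assms(6,7) unfolding homogeneous_attractor_def inhomogeneous_attractor_def by auto
  then have "F0 = UNIV" "FC = UNIV" "C = UNIV" using univ assms(5) by blast+
  then show ?thesis by simp
qed

end
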